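(* Let $M$ be a manifold. For each pair $(\mathcal A,\mathcal B)$ among $(\mathcal K,\mathcal O)$, $(\mathcal K,\Lambda)$, $(\mathcal K,\Omega)$, $(\mathcal K,\mathcal K)$, the manifold $M$ is metrisable if and only if $M$ satisfies the selection principle $\mathsf S_1(\mathcal A,\mathcal B)$.
   Context: A manifold is a non-empty, connected, Hausdorff space each point of which has a neighbourhood homeomorphic to $\mathbb R^n$ for some natural number $n$. An open cover of a space $X$ is a set of open subsets of $X$ whose union is $X$; covers are not assumed to be countable. For a space $X$: - $\mathcal O$ is the family of all open covers of $X$. - $\Lambda$ is the family of large covers of $X$: open covers $\mathcal U$ such that $X\notin\mathcal U$ and every point of $X$ is contained in infinitely many members of $\mathcal U$. - $\Omega$ is the family of $\omega$-covers of $X$: open covers $\mathcal U$ such that $X\notin\mathcal U$ and every finite subset of $X$ is contained in some member of $\mathcal U$. - $\mathcal K$ is the family of $k$-covers of $X$: open covers $\mathcal U$ such that $X\notin\mathcal U$ and every compact subset of $X$ is contained in some member of $\mathcal U$. A space $X$ satisfies $\mathsf S_1(\mathcal A,\mathcal B)$ if for each sequence $\langle A_n\rangle_{n\in\omega}$ of members of $\mathcal A$ there is a sequence $\langle b_n\rangle_{n\in\omega}$ such that $b_n\in A_n$ for each $n$ and $\{b_n : n\in\omega\}\in\mathcal B$. *)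

theory Defs
  imports "HOL-Analysis.Analysis"
begin

text \<open>
  The dimension may a priori depend on the point, dimension 0 is allowed, and neither second
  countability nor paracompactness is assumed. A neighbourhood of a point is any set with the
  point in its interior; it need not be open.
\<close>

definition manifold :: "'a topology \<Rightarrow> bool" where
  "manifold M \<longleftrightarrow>
     topspace M \<noteq> {} \<and> connected_space M \<and> Hausdorff_space M \<and>
     (\<forall>x\<in>topspace M. \<exists>N n. N \<subseteq> topspace M \<and> x \<in> M interior_of N \<and>
        subtopology M N homeomorphic_space Euclidean_space n)"

definition open_covers :: "'a topology \<Rightarrow> 'a set set set" where
  "open_covers X = {\<U>. (\<forall>U\<in>\<U>. openin X U) \<and> \<Union>\<U> = topspace X}"

definition large_covers :: "'a topology \<Rightarrow> 'a set set set" where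
  "large_covers X =
     {\<U> \<in> open_covers X. topspace X \<notin> \<U> \<and> (\<forall>x\<in>topspace X. infinite {U \<in> \<U>. x \<in> U})}"

definition omega_covers :: "'a topology \<Rightarrow> 'a set set set" where
  "omega_covers X =
     {\<U> \<in> open_covers X. topspace X \<notin> \<U> \<and>
        (\<forall>F. finite F \<and> F \<subseteq> topspace X \<longrightarrow> (\<exists>U\<in>\<U>. F \<subseteq> U))}"

definition k_covers :: "'a topology \<Rightarrow> 'a set set set" where
  "k_covers X =
     {\<U> \<in> open_covers X. topspace X \<notin> \<U> \<and>
        (\<forall>K. compactin X K \<longrightarrow> (\<exists>U\<in>\<U>. K \<subseteq> U))}"

definition S1 :: "'b set set \<Rightarrow> 'b set set \<Rightarrow> bool" where
  "S1 \<A> \<B> \<longleftrightarrow>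
     (\<forall>A :: nat \<Rightarrow> 'b set. (\<forall>n. A n \<in> \<A>) \<longrightarrow>
        (\<exists>b. (\<forall>n. b n \<in> A n) \<and> range b \<in> \<B>))"

end

theory Submission
  imports Defs
begin

text \<open>
  For a manifold, metrisability, second countability and the Lindelof property coincide. Chopping
  a countable cover of a Lindelof manifold by relatively compact open sets into its finite initial
  unions yields compact sets absorbing every compact set, from which a k-cover can be selected.
  Conversely, in a noncompact manifold the relatively compact open sets form a k-cover, and any
  countable cover selected from it witnesses that the manifold is sigma-compact.
\<close>

section \<open>Countability properties and metrisability\<close>

text \<open>Countably many real functions separate points from closed sets, so evaluating all of
  them at once embeds \<open>X\<close> into a countable power of the reals, which is
  metrisable.\<close>

theorem Urysohn_metrization:
  fixes X :: "'a topology"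
  assumes "regular_space X" "Hausdorff_space X" "second_countable X"
  shows "metrizable_space X"
proof -
  have "normal_space X"
    using assms regular_Lindelof_imp_normal_space second_countable_imp_Lindelof_space by blast
  then have creg: "completely_regular_space X"
    using assms(2) Hausdorff_imp_t1_space normal_imp_completely_regular_space by blast
  obtain \<B> where "countable \<B>" and op: "\<And>V. V \<in> \<B> \<Longrightarrow> openin X V"
    and base: "\<And>U x. openin X U \<Longrightarrow> x \<in> U \<Longrightarrow> \<exists>V\<in>\<B>. x \<in> V \<and> V \<subseteq> U"
    using assms(3) unfolding second_countable_def by metis
  \<comment> \<open>For \<open>p = (U, V)\<close>, one function with values below 1/2 on
    \<open>U\<close> and equal to 1 off \<open>V\<close> serves every point of \<open>U\<close>.
    Indexing by pairs of basic sets keeps the family countable.\<close>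
  define separates :: "('a \<Rightarrow> real) \<Rightarrow> 'a set \<times> 'a set \<Rightarrow> bool" where
    "separates f p \<longleftrightarrow> continuous_map X euclideanreal f \<and> (\<forall>y\<in>fst p. f y < 1/2) \<and>
       (\<forall>y\<in>topspace X - snd p. f y = 1)" for f p
  define P where "P = {p \<in> \<B> \<times> \<B>. \<exists>f. separates f p}"
  have "countable P"
    unfolding P_def using \<open>countable \<B>\<close> by (simp add: countable_Collect)
  have "\<forall>p\<in>P. \<exists>f. separates f p"
    unfolding P_def by blast
  then obtain g where g: "\<And>p. p \<in> P \<Longrightarrow> separates (g p) p"
    by metis
  have ex_sep: "\<exists>U V. (U, V) \<in> P \<and> x \<in> U \<and> V \<subseteq> W" if W: "openin X W" "x \<in> W" for W x
  proof -
    obtain V where V: "V \<in> \<B>" "x \<in> V" "V \<subseteq> W"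
      using base W by meson
    obtain f where f: "continuous_map X euclideanreal f" "f x = 0" "f ` (topspace X - V) \<subseteq> {1}"
      using creg op V unfolding completely_regular_space_alt' by metis
    \<comment> \<open>The sublevel set of \<open>f\<close> leaves room for a basic set
      \<open>U\<close> around \<open>x\<close>, so the same \<open>f\<close> separates the pair
      \<open>(U, V)\<close>.\<close>
    have "openin X {y \<in> topspace X. f y \<in> {..<1/2}}"
      using f(1) by (rule openin_continuous_map_preimage) simp
    then obtain U where U: "U \<in> \<B>" "x \<in> U" "U \<subseteq> {y \<in> topspace X. f y \<in> {..<1/2}}"
      using base[of "{y \<in> topspace X. f y \<in> {..<1/2}}" x] f(2) W openin_subset by fastforce
    have "separates f (U, V)"
      using f U(3) unfolding separates_def by auto
    then show ?thesis
      using U V unfolding P_def by blast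
  qed
  define Y where "Y = product_topology (\<lambda>_. euclideanreal) P"
  define e where "e x = restrict (\<lambda>p. g p x) P" for x
  have "metrizable_space Y"
    unfolding Y_def metrizable_space_product_topology
    using \<open>countable P\<close> by (simp add: countable_Collect metrizable_space_euclidean[where 'a = real])
  have cont: "continuous_map X Y e"
    using g unfolding Y_def e_def separates_def by (auto simp: continuous_map_componentwise)
  have inj: "inj_on e (topspace X)"
  proof (rule inj_onI, rule ccontr)
    fix x y assume xy: "x \<in> topspace X" "y \<in> topspace X" "e x = e y" "x \<noteq> y"
    then have "openin X (topspace X - {y})"
      by (simp add: assms(2) closedin_Hausdorff_singleton openin_diff)
    then obtain U V where UV: "(U, V) \<in> P" "x \<in> U" "V \<subseteq> topspace X - {y}"
      using ex_sep[of "topspace X - {y}" x] xy by blast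
    then have "g (U, V) x < 1/2" "g (U, V) y = 1"
      using g[OF UV(1)] xy(2) unfolding separates_def by auto
    moreover have "g (U, V) x = g (U, V) y"
      using xy(3) UV(1) unfolding e_def by (metis restrict_apply')
    ultimately show False by simp
  qed
  have "open_map X (subtopology Y (e ` topspace X)) e"
    unfolding open_map_def
  proof (intro allI impI)
    fix W assume W: "openin X W"
    show "openin (subtopology Y (e ` topspace X)) (e ` W)"
    proof (subst openin_subopen, intro ballI)
      fix z assume "z \<in> e ` W"
      then obtain x where x: "x \<in> W" "z = e x" by blast
      then obtain U V where UV: "(U, V) \<in> P" "x \<in> U" "V \<subseteq> W"
        using ex_sep W by blast
      \<comment> \<open>One coordinate suffices: it equals 1 at points off \<open>V\<close>, so
        every image point in the open slab \<open>T\<close> comes from \<open>V\<close>, hence from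
        \<open>W\<close>.\<close>
      define T where "T = {z \<in> topspace Y. z (U, V) \<in> {..<1/2}}"
      have "continuous_map Y euclideanreal (\<lambda>z. z (U, V))"
        unfolding Y_def by (rule continuous_map_product_projection) (rule UV(1))
      then have "openin Y T"
        unfolding T_def by (rule openin_continuous_map_preimage) simp
      moreover have "z \<in> T"
        using g[OF UV(1)] UV x W cont openin_subset[OF W]
        unfolding T_def separates_def by (auto simp: e_def Y_def)
      moreover have "T \<inter> e ` topspace X \<subseteq> e ` W"
      proof
        fix t assume "t \<in> T \<inter> e ` topspace X"
        then obtain y where y: "y \<in> topspace X" "t = e y" "g (U, V) y < 1/2"
          using UV(1) unfolding T_def e_def by auto
        then have "y \<in> V"
          using g[OF UV(1)] unfolding separates_def by force
        then show "t \<in> e ` W" using UV(3) y by blast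
      qed
      ultimately show "\<exists>T. openin (subtopology Y (e ` topspace X)) T \<and> z \<in> T \<and> T \<subseteq> e ` W"
        using x openin_subset[OF W] by (intro exI[of _ "T \<inter> e ` topspace X"])
          (auto simp: openin_subtopology)
    qed
  qed
  then have "homeomorphic_map X (subtopology Y (e ` topspace X)) e"
    using cont inj by (intro bijective_open_imp_homeomorphic_map)
      (auto simp: continuous_map_in_subtopology continuous_map_image_subset_topspace
         dest: continuous_map_image_subset_topspace)
  then show ?thesis
    using \<open>metrizable_space Y\<close> homeomorphic_metrizable_space homeomorphic_map_imp_homeomorphic_space
      metrizable_space_subtopology by blast
qed

section \<open>From local to global second countability\<close>

definition locally_second_countable :: "'a topology \<Rightarrow> bool" where
  "locally_second_countable X \<longleftrightarrow>
     (\<forall>x\<in>topspace X. \<exists>U. openin X U \<and> x \<in> U \<and> second_countable (subtopology X U))"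

text \<open>Countably many second countable open sets cover \<open>X\<close>, and the union of their
  countable bases is a base, since a set open in an open subspace is open in
  \<open>X\<close>.\<close>

lemma second_countable_if_locally_if_Lindelof:
  assumes "locally_second_countable X" "Lindelof_space X"
  shows "second_countable X"
proof -
  let ?\<U> = "{U. openin X U \<and> second_countable (subtopology X U)}"
  have "\<Union>?\<U> = topspace X"
    using assms(1) openin_subset unfolding locally_second_countable_def by blast
  moreover have "openin X U" if "U \<in> ?\<U>" for U
    using that by simp
  ultimately obtain \<V> where \<V>: "countable \<V>" "\<V> \<subseteq> ?\<U>" "\<Union>\<V> = topspace X"
    using Lindelof_spaceD[OF assms(2), of ?\<U>] by metis
  then have "\<forall>U\<in>\<V>. \<exists>\<B>. countable \<B> \<and> (\<forall>V\<in>\<B>. openin (subtopology X U) V) \<and>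
      (\<forall>W x. openin (subtopology X U) W \<and> x \<in> W \<longrightarrow> (\<exists>V\<in>\<B>. x \<in> V \<and> V \<subseteq> W))"
    unfolding second_countable_def by blast
  then obtain \<B> where \<B>: "\<And>U. U \<in> \<V> \<Longrightarrow> countable (\<B> U)"
      "\<And>U V. U \<in> \<V> \<Longrightarrow> V \<in> \<B> U \<Longrightarrow> openin (subtopology X U) V"
      "\<And>U W x. U \<in> \<V> \<Longrightarrow> openin (subtopology X U) W \<Longrightarrow> x \<in> W \<Longrightarrow> \<exists>V\<in>\<B> U. x \<in> V \<and> V \<subseteq> W"
    by metis
  show ?thesis
    unfolding second_countable_def
  proof (intro exI[of _ "\<Union>(\<B> ` \<V>)"] conjI ballI allI impI)
    show "countable (\<Union>(\<B> ` \<V>))"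
      using \<V>(1) \<B>(1) by simp
    show "openin X V" if "V \<in> \<Union>(\<B> ` \<V>)" for V
      using that \<B>(2) \<V>(2) openin_open_subtopology by blast
    show "\<exists>V\<in>\<Union>(\<B> ` \<V>). x \<in> V \<and> V \<subseteq> W" if W: "openin X W \<and> x \<in> W" for W x
    proof -
      obtain U where U: "U \<in> \<V>" "x \<in> U"
        using W \<V>(3) openin_subset by blast
      then show ?thesis
        using \<B>(3)[of U "U \<inter> W" x] W openin_subtopology_Int2[of X W U] by blast
    qed
  qed
qed

lemma (in Metric_space) separable_imp_second_countable:
  assumes "separable_space mtopology"
  shows "second_countable mtopology"
proof -
  obtain C where C: "countable C" "C \<subseteq> M" "mtopology closure_of C = M"
    using assms unfolding separable_space_def by auto
  \<comment> \<open>Balls of nonpositive radius are empty and do no harm in a base.\<close>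
  let ?\<B> = "(\<lambda>(c, q). mball c q) ` (C \<times> \<rat>)"
  show ?thesis
    unfolding second_countable_def
  proof (intro exI[of _ ?\<B>] conjI allI impI)
    show "countable ?\<B>"
      using C(1) countable_rat by blast
    show "\<forall>V\<in>?\<B>. openin mtopology V" by auto
    show "\<exists>V\<in>?\<B>. x \<in> V \<and> V \<subseteq> U" if U: "openin mtopology U \<and> x \<in> U" for U x
    proof -
      obtain r where r: "r > 0" "mball x r \<subseteq> U" and x: "x \<in> M"
        using U unfolding openin_mtopology by blast
      \<comment> \<open>With \<open>q < r/2\<close>, a ball of radius \<open>q\<close> about a
        centre closer than \<open>q\<close> to \<open>x\<close> contains \<open>x\<close> and stays
        inside \<open>mball x r\<close>.\<close>
      obtain q where q: "q \<in> \<rat>" "0 < q" "q < r/2"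
        using Rats_dense_in_real[of 0 "r/2"] r(1) by auto
      obtain c where c: "c \<in> C" "d x c < q"
        using x q(2) C(3) unfolding metric_closure_of by fastforce
      have "mball c q \<subseteq> mball x r"
        using c q x C(2) by (intro mball_subset) (auto simp: commute)
      then show ?thesis
        using r(2) c q x C(2) by (intro bexI[of _ "mball c q"]) (auto simp: commute)
    qed
  qed
qed

text \<open>
  A countable set is closed up under adding dense subsets of all separable rational balls around
  its points; the closure of the result is clopen.
\<close>

lemma (in Metric_space) separable_if_connected_if_locally:
  assumes conn: "connected_space mtopology" and loc: "locally_second_countable mtopology"
  shows "separable_space mtopology"
proof (cases "M = {}")
  case True
  then have "topspace mtopology = {}"
    by (metis topspace_mtopology)
  then show ?thesis
    unfolding separable_space_def
    by (intro exI[of _ "{}"]) (simp only: closure_of_empty countable_empty empty_subsetI simp_thms)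
next
  case False
  then obtain a where a: "a \<in> M" by blast
  \<comment> \<open>Nothing is asked of where \<open>C\<close> lies, so this form of separability
    passes to subsets at once.\<close>
  define sep where "sep S \<longleftrightarrow> (\<exists>C. countable C \<and> S \<subseteq> mtopology closure_of C)" for S
  \<comment> \<open>The condition \<open>sep S\<close> is placed inside the existential so that
    \<open>D\<close> is total; its values at other sets are arbitrary.\<close>
  have "\<forall>S. \<exists>C. sep S \<longrightarrow> countable C \<and> S \<subseteq> mtopology closure_of C"
    unfolding sep_def by blast
  then obtain D where D: "\<And>S. sep S \<Longrightarrow> countable (D S)" "\<And>S. sep S \<Longrightarrow> S \<subseteq> mtopology closure_of (D S)"
    by metis
  define step where "step C = C \<union> \<Union>(D ` {S. sep S \<and> S \<in> (\<lambda>(c, q). mball c q) ` (C \<times> \<rat>)})" for C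
  define E where "E = (\<Union>n. (step ^^ n) {a})"
  have "countable (step C)" if "countable C" for C
  proof -
    have "countable ((\<lambda>(c, q). mball c q) ` (C \<times> \<rat>))"
      using that countable_rat by blast
    then have "countable {S. sep S \<and> S \<in> (\<lambda>(c, q). mball c q) ` (C \<times> \<rat>)}"
      by (rule countable_subset[rotated]) blast
    then show ?thesis
      unfolding step_def using that D(1) by auto
  qed
  then have "countable ((step ^^ n) {a})" for n
    by (induction n) auto
  then have "countable E"
    unfolding E_def by simp
  \<comment> \<open>A centre present at stage \<open>n\<close> has the set
    \<open>D (mball c q)\<close> added at stage \<open>Suc n\<close>.\<close>
  have ball: "mball c q \<subseteq> mtopology closure_of E" if "c \<in> E" "q \<in> \<rat>" "sep (mball c q)" for c q
  proof -
    obtain n where "c \<in> (step ^^ n) {a}"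
      using \<open>c \<in> E\<close> unfolding E_def by blast
    then have "D (mball c q) \<subseteq> (step ^^ Suc n) {a}"
      using that unfolding step_def by auto
    then have "D (mball c q) \<subseteq> E"
      unfolding E_def by blast
    then show ?thesis
      using D(2)[OF that(3)] closure_of_mono by blast
  qed
  \<comment> \<open>A point \<open>y\<close> of the closure has a separable neighbourhood
    \<open>U\<close>. Some \<open>c\<close> in \<open>E\<close> is so close to \<open>y\<close> that
    a rational ball about \<open>c\<close> contains \<open>y\<close> and lies in \<open>U\<close>;
    this ball is separable, hence already absorbed by the closure.\<close>
  have "openin mtopology (mtopology closure_of E)"
  proof (subst openin_subopen, intro ballI)
    fix y assume y: "y \<in> mtopology closure_of E"
    then have "y \<in> M"
      using closure_of_subset_topspace by fastforce
    then obtain U where U: "openin mtopology U" "y \<in> U" "second_countable (subtopology mtopology U)"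
      using loc unfolding locally_second_countable_def by auto
    then obtain C where C: "countable C" "subtopology mtopology U closure_of C = U"
      using second_countable_imp_separable_space openin_subset[OF U(1)]
      unfolding separable_space_def by (metis topspace_subtopology_subset)
    then have "U \<subseteq> mtopology closure_of C"
      by (metis closure_of_subtopology_subset)
    then have "sep U"
      using C(1) unfolding sep_def by blast
    obtain r where r: "r > 0" "mball y r \<subseteq> U"
      using U unfolding openin_mtopology by blast
    obtain q where q: "q \<in> \<rat>" "0 < q" "q < r/2"
      using Rats_dense_in_real[of 0 "r/2"] r(1) by auto
    obtain c where c: "c \<in> E" "c \<in> M" "d y c < q"
      using y q(2) unfolding metric_closure_of by auto
    have "mball c q \<subseteq> U"
      using mball_subset[of c y q r] c q \<open>y \<in> M\<close> r(2) by (auto simp: commute)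
    then have "sep (mball c q)"
      using \<open>sep U\<close> unfolding sep_def by (meson order_trans)
    then show "\<exists>T. openin mtopology T \<and> y \<in> T \<and> T \<subseteq> mtopology closure_of E"
      using ball[OF c(1) q(1)] c \<open>y \<in> M\<close>
      by (intro exI[of _ "mball c q"]) (auto simp: commute)
  qed
  moreover have "a \<in> E"
    unfolding E_def by (rule UN_I[of 0]) auto
  then have "mtopology closure_of E \<noteq> {}"
    using a closure_of_subset_Int[of mtopology E] by auto
  ultimately have "mtopology closure_of E = M"
    using conn unfolding connected_space_clopen_in by (metis closedin_closure_of topspace_mtopology)
  \<comment> \<open>\<open>E\<close> is cut down to \<open>M\<close> because the sets chosen by
    \<open>D\<close> may leave the space; the closure stays the same.\<close>
  then show ?thesis
    unfolding separable_space_def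
    using \<open>countable E\<close> closure_of_restrict[of mtopology E]
    by (intro exI[of _ "M \<inter> E"]) auto
qed

lemma metrizable_connected_imp_second_countable:
  assumes "metrizable_space X" "connected_space X" "locally_second_countable X"
  shows "second_countable X"
proof -
  obtain S d where "Metric_space S d" and X: "X = Metric_space.mtopology S d"
    using assms(1) unfolding metrizable_space_def by blast
  then have "separable_space X"
    using assms(2,3) Metric_space.separable_if_connected_if_locally by metis
  then show ?thesis
    using \<open>Metric_space S d\<close> X Metric_space.separable_imp_second_countable by metis
qed

section \<open>Local properties of manifolds\<close>

text \<open>\<open>Euclidean_space n\<close> is a subspace of the product topology on
  \<open>nat \<Rightarrow> real\<close>, from which it inherits a countable base.\<close>

lemma second_countable_Euclidean_space: "second_countable (Euclidean_space n)"
proof -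
  obtain \<B> :: "(nat \<Rightarrow> real) set set" where \<B>: "countable \<B>" "topological_basis \<B>"
    using ex_countable_basis by blast
  have "second_countable (euclidean :: (nat \<Rightarrow> real) topology)"
    unfolding second_countable_def
    using \<B> topological_basis_open[OF \<B>(2)] topological_basisE[OF \<B>(2)]
    by (intro exI[of _ \<B>]) (metis open_openin)
  then show ?thesis
    unfolding Euclidean_space_def euclidean_product_topology by (rule second_countable_subtopology)
qed

text \<open>Finiteness of the index set matters here: an infinite power of the real line is not
  locally compact.\<close>

lemma locally_compact_Euclidean_space: "locally_compact_space (Euclidean_space n)"
proof -
  have "locally_compact_space (product_topology (\<lambda>i. euclideanreal) {..<n})"
    unfolding locally_compact_space_product_topology by (simp add: locally_compact_space_euclidean)
  then show ?thesis
    using homeomorphic_Euclidean_space_product_topology homeomorphic_locally_compact_space by blast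
qed

lemma manifold_imp_locally_second_countable:
  assumes "manifold M"
  shows "locally_second_countable M"
  unfolding locally_second_countable_def
proof
  fix x assume "x \<in> topspace M"
  then obtain N n where N: "x \<in> M interior_of N" "subtopology M N homeomorphic_space Euclidean_space n"
    using assms unfolding manifold_def by blast
  then have "second_countable (subtopology M N)"
    using homeomorphic_space_second_countability second_countable_Euclidean_space by blast
  \<comment> \<open>The chart set \<open>N\<close> need not be open, so the property is passed on to
    its interior.\<close>
  then have "second_countable (subtopology (subtopology M N) (M interior_of N))"
    by (rule second_countable_subtopology)
  then have "second_countable (subtopology M (M interior_of N))"
    by (simp add: subtopology_subtopology inf.absorb2 interior_of_subset)
  then show "\<exists>U. openin M U \<and> x \<in> U \<and> second_countable (subtopology M U)"
    using N(1) openin_interior_of by metis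
qed

lemma manifold_imp_locally_compact_space:
  assumes "manifold M"
  shows "locally_compact_space M"
  unfolding locally_compact_space_def
proof
  fix x assume "x \<in> topspace M"
  then obtain N n where N: "x \<in> M interior_of N" "subtopology M N homeomorphic_space Euclidean_space n"
    using assms unfolding manifold_def by blast
  then have "locally_compact_space (subtopology M N)"
    using homeomorphic_locally_compact_space locally_compact_Euclidean_space by blast
  moreover have "x \<in> topspace (subtopology M N)"
    using N(1) \<open>x \<in> topspace M\<close> interior_of_subset[of M N] by auto
  ultimately obtain U K where UK: "openin (subtopology M N) U" "compactin (subtopology M N) K"
      "x \<in> U" "U \<subseteq> K"
    unfolding locally_compact_space_def by blast
  then obtain T where T: "openin M T" "U = T \<inter> N"
    unfolding openin_subtopology by blast
  \<comment> \<open>\<open>U\<close> is open only relative to \<open>N\<close>; meeting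
    \<open>T\<close> with the interior of \<open>N\<close> gives a set open in \<open>M\<close> that
    still lies in \<open>K\<close>.\<close>
  have "T \<inter> M interior_of N \<subseteq> U"
    using T(2) interior_of_subset[of M N] by blast
  then show "\<exists>U K. openin M U \<and> compactin M K \<and> x \<in> U \<and> U \<subseteq> K"
    using T UK N(1) by (intro exI[of _ "T \<inter> M interior_of N"] exI[of _ K])
      (auto simp: compactin_subtopology)
qed

text \<open>Both directions pass through second countability: connectedness yields it from a metric,
  the Lindelof property yields it from the charts. Regularity for the metrisation comes from local
  compactness and the Hausdorff property.\<close>

lemma manifold_metrizable_iff_Lindelof:
  assumes "manifold M"
  shows "metrizable_space M \<longleftrightarrow> Lindelof_space M"
proof
  have M: "connected_space M" "Hausdorff_space M"
    using assms unfolding manifold_def by auto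
  have loc: "locally_second_countable M"
    using assms by (rule manifold_imp_locally_second_countable)
  show "Lindelof_space M" if "metrizable_space M"
    using that M(1) loc
    by (intro second_countable_imp_Lindelof_space metrizable_connected_imp_second_countable)
  have "regular_space M"
    using manifold_imp_locally_compact_space[OF assms] M(2)
    by (rule locally_compact_Hausdorff_imp_regular_space)
  then show "metrizable_space M" if "Lindelof_space M"
    using that M(2) loc
    by (intro Urysohn_metrization second_countable_if_locally_if_Lindelof)
qed

section \<open>Selection principles\<close>

lemma S1_mono: "S1 \<A> \<B> \<Longrightarrow> \<B> \<subseteq> \<C> \<Longrightarrow> S1 \<A> \<C>"
  unfolding S1_def by blast

lemma k_covers_subset_omega_covers: "k_covers X \<subseteq> omega_covers X"
proof
  fix \<U> assume \<U>: "\<U> \<in> k_covers X"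
  have "\<exists>U\<in>\<U>. F \<subseteq> U" if "finite F" "F \<subseteq> topspace X" for F
  proof -
    have "compactin X F"
      using that by (simp add: finite_imp_compactin)
    then show ?thesis
      using \<U> by (simp add: k_covers_def)
  qed
  then show "\<U> \<in> omega_covers X"
    using \<U> by (simp add: k_covers_def omega_covers_def)
qed

text \<open>If only finitely many members contained \<open>x\<close>, choose a point outside each of
  them. A member containing \<open>x\<close> and all these points would be one of the finitely many,
  yet would miss its own chosen point.\<close>

lemma omega_covers_subset_large_covers: "omega_covers X \<subseteq> large_covers X"
proof
  fix \<U> assume \<U>: "\<U> \<in> omega_covers X"
  have "infinite {U \<in> \<U>. x \<in> U}" if x: "x \<in> topspace X" for x
  proof
    assume fin: "finite {U \<in> \<U>. x \<in> U}"
    have "U \<subset> topspace X" if "U \<in> \<U>" for U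
    proof
      show "U \<subseteq> topspace X" "U \<noteq> topspace X"
        using \<U> that unfolding omega_covers_def open_covers_def by auto
    qed
    then have "\<forall>U\<in>\<U>. \<exists>p. p \<in> topspace X - U"
      by blast
    then obtain p where p: "\<And>U. U \<in> \<U> \<Longrightarrow> p U \<in> topspace X - U"
      by metis
    let ?F = "insert x (p ` {U \<in> \<U>. x \<in> U})"
    have "finite ?F" "?F \<subseteq> topspace X"
      using fin x p by auto
    then obtain U where "U \<in> \<U>" "?F \<subseteq> U"
      using \<U> unfolding omega_covers_def by blast
    then show False
      using p by blast
  qed
  then show "\<U> \<in> large_covers X"
    using \<U> unfolding omega_covers_def large_covers_def by blast
qed

lemma large_covers_subset_open_covers: "large_covers X \<subseteq> open_covers X"
  unfolding large_covers_def by (rule Collect_restrict)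

section \<open>Relatively compact open sets\<close>

text \<open>Lying in some compact set replaces compactness of the closure; in Hausdorff spaces the
  two agree.\<close>

definition relatively_compact_opens :: "'a topology \<Rightarrow> 'a set set" where
  "relatively_compact_opens X = {U. openin X U \<and> (\<exists>K. compactin X K \<and> U \<subseteq> K)}"

lemma relatively_compact_opensE:
  assumes "U \<in> relatively_compact_opens X"
  obtains K where "openin X U" "compactin X K" "U \<subseteq> K"
  using assms unfolding relatively_compact_opens_def by blast

lemma Union_relatively_compact_opens:
  assumes "locally_compact_space X"
  shows "\<Union>(relatively_compact_opens X) = topspace X"
proof
  show "\<Union>(relatively_compact_opens X) \<subseteq> topspace X"
    by (meson Union_least openin_subset relatively_compact_opensE)
  show "topspace X \<subseteq> \<Union>(relatively_compact_opens X)"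
  proof
    fix x assume "x \<in> topspace X"
    then obtain U K where "openin X U" "compactin X K" "x \<in> U" "U \<subseteq> K"
      using assms unfolding locally_compact_space_def by meson
    then show "x \<in> \<Union>(relatively_compact_opens X)"
      unfolding relatively_compact_opens_def by auto
  qed
qed

text \<open>Closure under finite unions is what lets a cover by such sets absorb compact sets, not
  merely points.\<close>

lemma Union_in_relatively_compact_opens:
  assumes "finite \<F>" "\<F> \<subseteq> relatively_compact_opens X"
  shows "\<Union>\<F> \<in> relatively_compact_opens X"
  using assms
proof (induction rule: finite_induct)
  case empty
  then show ?case
    unfolding relatively_compact_opens_def by auto
next
  case (insert U \<F>)
  then obtain K L where "openin X U" "compactin X K" "U \<subseteq> K"
      "openin X (\<Union>\<F>)" "compactin X L" "\<Union>\<F> \<subseteq> L"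
    by (meson insert_subset relatively_compact_opensE)
  then have "openin X (U \<union> \<Union>\<F>)" "compactin X (K \<union> L)" "U \<union> \<Union>\<F> \<subseteq> K \<union> L"
    by (auto intro: compactin_Un)
  then show ?case
    unfolding relatively_compact_opens_def by auto
qed

text \<open>Noncompactness keeps the whole space out of the family: a compact set containing it
  would be the space itself.\<close>

lemma relatively_compact_opens_in_k_covers:
  assumes "locally_compact_space X" "\<not> compact_space X"
  shows "relatively_compact_opens X \<in> k_covers X"
proof -
  have "topspace X \<notin> relatively_compact_opens X"
    using assms(2) compactin_subset_topspace unfolding compact_space_def
    by (metis relatively_compact_opensE subset_antisym)
  moreover have "\<exists>U\<in>relatively_compact_opens X. C \<subseteq> U" if C: "compactin X C" for C
  proof -
    have "C \<subseteq> \<Union>(relatively_compact_opens X)"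
      using compactin_subset_topspace[OF C] Union_relatively_compact_opens[OF assms(1)] by simp
    then obtain \<F> where "finite \<F>" "\<F> \<subseteq> relatively_compact_opens X" "C \<subseteq> \<Union>\<F>"
      using compactinD[OF C] by (metis relatively_compact_opensE)
    then show ?thesis
      using Union_in_relatively_compact_opens by blast
  qed
  moreover have "\<forall>U\<in>relatively_compact_opens X. openin X U"
    by (meson relatively_compact_opensE)
  ultimately show ?thesis
    unfolding k_covers_def open_covers_def using Union_relatively_compact_opens[OF assms(1)] by simp
qed

section \<open>The Lindelof property and the selection principles\<close>

lemma Lindelof_imp_S1_k_covers:
  assumes "locally_compact_space X" "Lindelof_space X"
  shows "S1 (k_covers X) (k_covers X)"
  unfolding S1_def
proof (intro allI impI)
  fix A assume A: "\<forall>n::nat. A n \<in> k_covers X"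
  obtain \<V> where \<V>: "countable \<V>" "\<V> \<subseteq> relatively_compact_opens X" "\<Union>\<V> = topspace X"
    using Lindelof_spaceD[OF assms(2) _ Union_relatively_compact_opens[OF assms(1)]]
    by (metis relatively_compact_opensE)
  \<comment> \<open>the empty set guarantees that the cover can be enumerated\<close>
  define V where "V = from_nat_into (insert {} \<V>)"
  have range_V: "range V = insert {} \<V>"
    unfolding V_def using \<V>(1) by (intro range_from_nat_into) auto
  have "openin X (V n) \<and> (\<exists>K. compactin X K \<and> V n \<subseteq> K)" for n
  proof -
    have "V n \<in> insert {} \<V>"
      using range_V by blast
    then show ?thesis
      using \<V>(2) by (metis compactin_empty insert_iff openin_empty relatively_compact_opensE
          subsetD subset_refl)
  qed
  then obtain K where V: "\<And>n. openin X (V n)" and K: "\<And>n. compactin X (K n)" "\<And>n. V n \<subseteq> K n"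
    by metis
  \<comment> \<open>The \<open>n\<close>-th choice absorbs the compact sets \<open>K i\<close>
    instead of the open sets \<open>V i\<close>, since members of a k-cover are only guaranteed to
    contain compact sets.\<close>
  have "compactin X (\<Union>i\<le>n. K i)" for n
    using K(1) by (intro compactin_Union) auto
  then have "\<exists>U\<in>A n. (\<Union>i\<le>n. K i) \<subseteq> U" for n
    using A unfolding k_covers_def by blast
  then obtain b where b: "\<And>n. b n \<in> A n" "\<And>n. (\<Union>i\<le>n. K i) \<subseteq> b n"
    by metis
  have open_b: "openin X (b n)" and b_neq: "b n \<noteq> topspace X" for n
    using A[rule_format, of n] b(1)[of n] unfolding k_covers_def open_covers_def by auto
  have cov: "\<exists>n. C \<subseteq> b n" if C: "compactin X C" for C
  proof -
    have "C \<subseteq> \<Union>(range V)"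
      using compactin_subset_topspace[OF C] \<V>(3) range_V by auto
    then obtain \<F> where \<F>: "finite \<F>" "\<F> \<subseteq> range V" "C \<subseteq> \<Union>\<F>"
      using compactinD[OF C, of "range V"] V by blast
    then obtain J where J: "finite J" "\<F> = V ` J"
      by (meson finite_subset_image)
    \<comment> \<open>Finitely many indices are bounded by some \<open>n\<close>, and
      \<open>b n\<close> contains all of \<open>K 0\<close> up to \<open>K n\<close>.\<close>
    then obtain n where "J \<subseteq> {..n}"
      using finite_nat_iff_bounded_le by blast
    then have "C \<subseteq> (\<Union>i\<le>n. K i)"
      using \<F>(3) J(2) K(2) by blast
    then show ?thesis
      using b(2) by blast
  qed
  have "x \<in> \<Union>(range b)" if "x \<in> topspace X" for x
    using cov[of "{x}"] that by auto
  then have "\<Union>(range b) = topspace X"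
    using openin_subset[OF open_b] by blast
  then have "range b \<in> k_covers X"
    unfolding k_covers_def open_covers_def using open_b b_neq[symmetric] cov by (simp add: image_iff)
  then show "\<exists>b. (\<forall>n. b n \<in> A n) \<and> range b \<in> k_covers X"
    using b(1) by blast
qed

text \<open>The principle is applied to the constant sequence of relatively compact open sets. The
  compact case is treated apart because that family then contains the whole space.\<close>

lemma S1_imp_Lindelof:
  assumes loc: "locally_compact_space X" and S1: "S1 (k_covers X) (open_covers X)"
  shows "Lindelof_space X"
proof (cases "compact_space X")
  case True
  then show ?thesis by (rule compact_imp_Lindelof_space)
next
  case False
  then have "relatively_compact_opens X \<in> k_covers X"
    using loc relatively_compact_opens_in_k_covers by blast
  then obtain b :: "nat \<Rightarrow> 'a set"
    where b: "\<And>n. b n \<in> relatively_compact_opens X" "range b \<in> open_covers X"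
    using S1[unfolded S1_def, rule_format, of "\<lambda>_. relatively_compact_opens X"] by blast
  have "\<forall>n. \<exists>K. compactin X K \<and> b n \<subseteq> K"
    using b(1) by (meson relatively_compact_opensE)
  then obtain K where K: "\<And>n. compactin X (K n)" "\<And>n. b n \<subseteq> K n"
    by metis
  \<comment> \<open>The space is exhausted by countably many compact sets, and a countable union of
    Lindelof subspaces is Lindelof.\<close>
  have "\<Union>(range K) = topspace X"
  proof
    show "\<Union>(range K) \<subseteq> topspace X"
      using compactin_subset_topspace[OF K(1)] by (rule UN_least)
    have "topspace X = \<Union>(range b)"
      using b(2) by (simp add: open_covers_def)
    also have "\<dots> \<subseteq> \<Union>(range K)"
      using K(2) by (rule UN_mono[OF subset_refl])
    finally show "topspace X \<subseteq> \<Union>(range K)" .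
  qed
  moreover have "Lindelof_space (subtopology X (\<Union>(range K)))"
    using K(1) by (intro Lindelof_space_Union)
      (auto intro: compact_imp_Lindelof_space compact_space_subtopology)
  ultimately show ?thesis by simp
qed

theorem theorem1p3:
  fixes M :: "'a topology" and \<A> \<B> :: "'a set set set"
  assumes "manifold M"
    and "(\<A>, \<B>) \<in> {(k_covers M, open_covers M), (k_covers M, large_covers M),
                      (k_covers M, omega_covers M), (k_covers M, k_covers M)}"
  shows "metrizable_space M \<longleftrightarrow> S1 \<A> \<B>"
proof -
  have loc: "locally_compact_space M"
    using assms(1) by (rule manifold_imp_locally_compact_space)
  \<comment> \<open>All four target families lie between \<open>k_covers M\<close> and
    \<open>open_covers M\<close>, so by monotonicity it suffices to have the strongest principle
    from Lindelof and to recover Lindelof from the weakest.\<close>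
  have \<A>: "\<A> = k_covers M" and \<B>: "k_covers M \<subseteq> \<B>" "\<B> \<subseteq> open_covers M"
    using assms(2) k_covers_subset_omega_covers[of M] omega_covers_subset_large_covers[of M]
      large_covers_subset_open_covers[of M] by auto
  have "Lindelof_space M \<longleftrightarrow> S1 \<A> \<B>"
    using Lindelof_imp_S1_k_covers[OF loc] S1_imp_Lindelof[OF loc] S1_mono \<B> unfolding \<A> by blast
  then show ?thesis
    using manifold_metrizable_iff_Lindelof[OF assms(1)] by blast
qed

end
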